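(* Let $1\leq p\leq q\leq\infty$, and let $X$ be a Tychonoff space. Then the following are equivalent: $C_p(X)$ has the property $EV^\ast_{(p,q)}$; $C_p(X)$ has the property $V^\ast_{(p,q)}$; $X$ is discrete.
   Context: $\mathbb{F}$ denotes $\mathbb{R}$ or $\mathbb{C}$. A Tychonoff space is a completely regular $T_1$ space. $C_p(X)$ is the space of continuous $\mathbb{F}$-valued functions on $X$ with the topology of pointwise convergence. For a locally convex space $E$ with topological dual $E'$, $E'_\beta$ is $E'$ with the strong topology $\beta(E',E)$. A subset $B\subseteq E'$ is equicontinuous if $B\subseteq U^\circ=\{\chi\in E':|\langle\chi,x\rangle|\le1\ \forall x\in U\}$ for some neighborhood $U$ of zero in $E$. A sequence $\{x_n\}_{n\in\omega}$ in a locally convex space $F$ is weakly $p$-summable if $(\langle\chi,x_n\rangle)_n\in\ell_p$ (or $\in c_0$ if $p=\infty$) for every $\chi\in F'$. A non-empty subset $A$ of $E$ is a $(p,q)$-$(V^\ast)$ set (resp. a $(p,q)$-$(EV^\ast)$ set) if $\big(\sup_{a\in A}|\langle\chi_n,a\rangle|\big)_n\in\ell_q$ (or $\in c_0$ if $q=\infty$) for every weakly $p$-summable sequence (resp. every equicontinuous weakly $p$-summable sequence) $\{\chi_n\}_{n\in\omega}$ in $E'_\beta$. $E$ has the property $V^\ast_{(p,q)}$ (resp. $EV^\ast_{(p,q)}$) if every $(p,q)$-$(V^\ast)$ (resp. $(p,q)$-$(EV^\ast)$) set in $E$ is relatively weakly compact (its weak closure in $E$ is weakly compact). *)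

theory Defs
  imports "HOL-Analysis.Analysis" "HOL-Library.Function_Algebras"
begin

text \<open>
  A topological vector space is given by a topology \<open>E\<close> whose \<open>topspace\<close> is a linear
  subspace of a type \<open>'v\<close>, together with a scalar multiplication \<open>s\<close> on \<open>'v\<close>; in this way
  a space, its strong dual, and the dual of the latter are treated by the same definitions.
  The scalar field \<open>'k\<close> is instantiated to \<open>real\<close> or \<open>complex\<close> where the notions are used.
\<close>

section \<open>Spaces of functions and duals\<close>

text \<open>Addition of functions is the pointwise one of \<open>Function_Algebras\<close>.\<close>

definition fscale :: "'k \<Rightarrow> ('i \<Rightarrow> 'k) \<Rightarrow> 'i \<Rightarrow> 'k::real_normed_field" where
  "fscale c f = (\<lambda>x. c * f x)"

text \<open>
  Functionals are set to 0 outside the space, so that each one has exactly one representative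
  and the representatives form a linear subspace of the function type.
\<close>

definition dual :: "('k \<Rightarrow> 'v \<Rightarrow> 'v) \<Rightarrow> 'v topology \<Rightarrow> ('v::ab_group_add \<Rightarrow> 'k::real_normed_field) set"
  where
  "dual s E = {\<phi>. continuous_map E euclidean \<phi>
      \<and> (\<forall>x\<in>topspace E. \<forall>y\<in>topspace E. \<phi> (x + y) = \<phi> x + \<phi> y)
      \<and> (\<forall>c. \<forall>x\<in>topspace E. \<phi> (s c x) = c * \<phi> x)
      \<and> (\<forall>x. x \<notin> topspace E \<longrightarrow> \<phi> x = 0)}"

definition zero_nbhd :: "'v topology \<Rightarrow> 'v::ab_group_add set \<Rightarrow> bool" where
  "zero_nbhd E U \<longleftrightarrow> U \<subseteq> topspace E \<and> (\<exists>V. openin E V \<and> 0 \<in> V \<and> V \<subseteq> U)"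

definition polar ::
  "('k \<Rightarrow> 'v \<Rightarrow> 'v) \<Rightarrow> 'v topology \<Rightarrow> 'v set \<Rightarrow> ('v::ab_group_add \<Rightarrow> 'k::real_normed_field) set"
  where
  "polar s E U = {\<phi> \<in> dual s E. \<forall>x\<in>U. norm (\<phi> x) \<le> 1}"

definition equicontinuous ::
  "('k \<Rightarrow> 'v \<Rightarrow> 'v) \<Rightarrow> 'v topology \<Rightarrow> ('v::ab_group_add \<Rightarrow> 'k::real_normed_field) set \<Rightarrow> bool"
  where
  "equicontinuous s E B \<longleftrightarrow> (\<exists>U. zero_nbhd E U \<and> B \<subseteq> polar s E U)"

section \<open>Strong and weak topologies\<close>

definition tvs_bounded ::
  "('k::real_normed_field \<Rightarrow> 'v \<Rightarrow> 'v) \<Rightarrow> 'v topology \<Rightarrow> 'v::ab_group_add set \<Rightarrow> bool" where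
  "tvs_bounded s E B \<longleftrightarrow> B \<subseteq> topspace E
      \<and> (\<forall>U. zero_nbhd E U \<longrightarrow> (\<exists>r>0. \<forall>c. r \<le> norm c \<longrightarrow> B \<subseteq> s c ` U))"

text \<open>
  The neighbourhoods of \<open>\<phi>\<close> are the supersets of the sets \<open>\<phi> + polar B\<close>, \<open>B\<close> bounded;
  these already form a neighbourhood base, since \<open>r *\<^sub>R polar B\<close> is the polar of the bounded
  set \<open>(1/r) *\<^sub>R B\<close>.
\<close>

definition strong_topology ::
  "('k \<Rightarrow> 'v \<Rightarrow> 'v) \<Rightarrow> 'v topology \<Rightarrow> ('v::ab_group_add \<Rightarrow> 'k::real_normed_field) topology"
  where
  "strong_topology s E = topology (\<lambda>U. U \<subseteq> dual s E
      \<and> (\<forall>\<phi>\<in>U. \<exists>B. tvs_bounded s E B \<and> (\<lambda>\<psi>. \<phi> + \<psi>) ` polar s E B \<subseteq> U))"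

definition weak_topology ::
  "('k::real_normed_field \<Rightarrow> 'v \<Rightarrow> 'v) \<Rightarrow> 'v topology \<Rightarrow> 'v::ab_group_add topology" where
  "weak_topology s E =
     topology_generated_by {{x \<in> topspace E. \<phi> x \<in> W} | \<phi> W. \<phi> \<in> dual s E \<and> open W}"

definition relatively_weakly_compact ::
  "('k::real_normed_field \<Rightarrow> 'v \<Rightarrow> 'v) \<Rightarrow> 'v topology \<Rightarrow> 'v::ab_group_add set \<Rightarrow> bool" where
  "relatively_weakly_compact s E A \<longleftrightarrow>
     compactin (weak_topology s E) (weak_topology s E closure_of A)"

section \<open>Summability and the properties \<open>V*\<close> and \<open>EV*\<close>\<close>

text \<open>Membership in \<open>\<ell>\<^sub>p\<close>, with \<open>c\<^sub>0\<close> in place of \<open>\<ell>\<^sub>\<infinity>\<close>; only meant for \<open>1 \<le> p\<close>.\<close>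

definition in_lp :: "ereal \<Rightarrow> (nat \<Rightarrow> 'k::real_normed_vector) \<Rightarrow> bool" where
  "in_lp p a \<longleftrightarrow> (if p = \<infinity> then a \<longlonglongrightarrow> 0
                  else summable (\<lambda>n. norm (a n) powr real_of_ereal p))"

definition weakly_summable ::
  "ereal \<Rightarrow> ('k::real_normed_field \<Rightarrow> 'v \<Rightarrow> 'v) \<Rightarrow> 'v topology \<Rightarrow> (nat \<Rightarrow> 'v::ab_group_add) \<Rightarrow> bool"
  where
  "weakly_summable p s F x \<longleftrightarrow>
     range x \<subseteq> topspace F \<and> (\<forall>\<phi>\<in>dual s F. in_lp p (\<lambda>n. \<phi> (x n)))"

text \<open>
  The real-valued supremum carries no information on unbounded sets, so its finiteness, which
  is implicit in membership in \<open>\<ell>\<^sub>q\<close> or \<open>c\<^sub>0\<close>, is required explicitly.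
\<close>

definition sup_in_lp :: "ereal \<Rightarrow> (nat \<Rightarrow> 'v \<Rightarrow> 'k::real_normed_field) \<Rightarrow> 'v set \<Rightarrow> bool" where
  "sup_in_lp q \<phi> A \<longleftrightarrow> (\<forall>n. bdd_above ((\<lambda>a. norm (\<phi> n a)) ` A))
      \<and> in_lp q (\<lambda>n. SUP a\<in>A. norm (\<phi> n a))"

definition Vstar_set ::
  "ereal \<Rightarrow> ereal \<Rightarrow> ('k::real_normed_field \<Rightarrow> 'v \<Rightarrow> 'v) \<Rightarrow> 'v topology \<Rightarrow> 'v::ab_group_add set \<Rightarrow> bool"
  where
  "Vstar_set p q s E A \<longleftrightarrow> A \<noteq> {} \<and> A \<subseteq> topspace E
      \<and> (\<forall>\<phi>. weakly_summable p fscale (strong_topology s E) \<phi> \<longrightarrow> sup_in_lp q \<phi> A)"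

definition EVstar_set ::
  "ereal \<Rightarrow> ereal \<Rightarrow> ('k::real_normed_field \<Rightarrow> 'v \<Rightarrow> 'v) \<Rightarrow> 'v topology \<Rightarrow> 'v::ab_group_add set \<Rightarrow> bool"
  where
  "EVstar_set p q s E A \<longleftrightarrow> A \<noteq> {} \<and> A \<subseteq> topspace E
      \<and> (\<forall>\<phi>. equicontinuous s E (range \<phi>) \<and> weakly_summable p fscale (strong_topology s E) \<phi>
             \<longrightarrow> sup_in_lp q \<phi> A)"

definition property_Vstar ::
  "ereal \<Rightarrow> ereal \<Rightarrow> ('k::real_normed_field \<Rightarrow> 'v \<Rightarrow> 'v) \<Rightarrow> 'v::ab_group_add topology \<Rightarrow> bool" where
  "property_Vstar p q s E \<longleftrightarrow> (\<forall>A. Vstar_set p q s E A \<longrightarrow> relatively_weakly_compact s E A)"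

definition property_EVstar ::
  "ereal \<Rightarrow> ereal \<Rightarrow> ('k::real_normed_field \<Rightarrow> 'v \<Rightarrow> 'v) \<Rightarrow> 'v::ab_group_add topology \<Rightarrow> bool" where
  "property_EVstar p q s E \<longleftrightarrow> (\<forall>A. EVstar_set p q s E A \<longrightarrow> relatively_weakly_compact s E A)"

section \<open>The space \<open>C\<^sub>p(X)\<close>\<close>

definition Tychonoff_space :: "'a topology \<Rightarrow> bool" where
  "Tychonoff_space X \<longleftrightarrow> completely_regular_space X \<and> t1_space X"

text \<open>
  Continuous functions on \<open>X\<close> are represented by their extensions by 0. The coordinates outside
  \<open>topspace X\<close> being constant, the topology below is that of pointwise convergence on \<open>X\<close>.
\<close>

definition Cp :: "'a topology \<Rightarrow> ('a \<Rightarrow> 'k::real_normed_field) topology" where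
  "Cp X = subtopology (product_topology (\<lambda>_. euclidean) UNIV)
     {f. continuous_map X euclidean f \<and> (\<forall>x. x \<notin> topspace X \<longrightarrow> f x = 0)}"

section \<open>Well-definedness\<close>

lemma tvs_bounded_Un:
  assumes "tvs_bounded s E B" "tvs_bounded s E C"
  shows "tvs_bounded s E (B \<union> C)"
  unfolding tvs_bounded_def
proof (intro conjI allI impI)
  show "B \<union> C \<subseteq> topspace E"
    using assms by (auto simp: tvs_bounded_def)
  fix U assume "zero_nbhd E U"
  then obtain r t where "r > 0" "\<And>c. r \<le> norm c \<Longrightarrow> B \<subseteq> s c ` U"
    and "t > 0" "\<And>c. t \<le> norm c \<Longrightarrow> C \<subseteq> s c ` U"
    using assms unfolding tvs_bounded_def by metis
  then show "\<exists>r>0. \<forall>c. r \<le> norm c \<longrightarrow> B \<union> C \<subseteq> s c ` U"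
    by (intro exI[of _ "max r t"]) auto
qed

lemma openin_strong_topology:
  "openin (strong_topology s E) U \<longleftrightarrow> U \<subseteq> dual s E
      \<and> (\<forall>\<phi>\<in>U. \<exists>B. tvs_bounded s E B \<and> (\<lambda>\<psi>. \<phi> + \<psi>) ` polar s E B \<subseteq> U)"
proof -
  let ?P = "\<lambda>U. U \<subseteq> dual s E
      \<and> (\<forall>\<phi>\<in>U. \<exists>B. tvs_bounded s E B \<and> (\<lambda>\<psi>. \<phi> + \<psi>) ` polar s E B \<subseteq> U)"
  have "istopology ?P"
    unfolding istopology_def
  proof (rule conjI; intro allI impI)
    fix S T assume S: "?P S" and T: "?P T"
    show "?P (S \<inter> T)"
    proof (intro conjI ballI)
      show "S \<inter> T \<subseteq> dual s E" using S by blast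
      fix \<phi> assume "\<phi> \<in> S \<inter> T"
      then obtain B C where "tvs_bounded s E B" "(\<lambda>\<psi>. \<phi> + \<psi>) ` polar s E B \<subseteq> S"
        and "tvs_bounded s E C" "(\<lambda>\<psi>. \<phi> + \<psi>) ` polar s E C \<subseteq> T"
        using S T by blast
      moreover have "polar s E (B \<union> C) \<subseteq> polar s E B \<inter> polar s E C"
        by (auto simp: polar_def)
      ultimately show "\<exists>B. tvs_bounded s E B \<and> (\<lambda>\<psi>. \<phi> + \<psi>) ` polar s E B \<subseteq> S \<inter> T"
        by (meson image_mono le_inf_iff order_trans tvs_bounded_Un)
    qed
  next
    fix K assume K: "\<forall>U\<in>K. ?P U"
    show "?P (\<Union>K)"
    proof (intro conjI ballI)
      show "\<Union>K \<subseteq> dual s E" using K by blast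
      fix \<phi> assume "\<phi> \<in> \<Union>K"
      then obtain U where U: "U \<in> K" "\<phi> \<in> U" by blast
      then obtain B where "tvs_bounded s E B" "(\<lambda>\<psi>. \<phi> + \<psi>) ` polar s E B \<subseteq> U"
        using K by meson
      with U show "\<exists>B. tvs_bounded s E B \<and> (\<lambda>\<psi>. \<phi> + \<psi>) ` polar s E B \<subseteq> \<Union>K"
        by blast
    qed
  qed
  then show ?thesis
    unfolding strong_topology_def by simp
qed

lemma tvs_bounded_empty: "tvs_bounded s E {}"
  by (auto simp: tvs_bounded_def intro: exI[of _ 1])

lemma dual_add:
  assumes "\<phi> \<in> dual s E" "\<psi> \<in> dual s E"
  shows "\<phi> + \<psi> \<in> dual s E"
  using assms
  by (auto simp: dual_def plus_fun_def algebra_simps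
      continuous_map_atin tendsto_add)

lemma topspace_strong_topology [simp]: "topspace (strong_topology s E) = dual s E"
proof
  show "topspace (strong_topology s E) \<subseteq> dual s E"
    using openin_topspace openin_strong_topology by blast
  have "openin (strong_topology s E) (dual s E)"
    unfolding openin_strong_topology
  proof (intro conjI ballI)
    fix \<phi> assume "\<phi> \<in> dual s E"
    then show "\<exists>B. tvs_bounded s E B \<and> (\<lambda>\<psi>. \<phi> + \<psi>) ` polar s E B \<subseteq> dual s E"
      by (intro exI[of _ "{}"]) (auto simp: tvs_bounded_empty polar_def dual_add)
  qed simp
  then show "dual s E \<subseteq> topspace (strong_topology s E)"
    by (rule openin_subset)
qed

lemma topspace_weak_topology [simp]: "topspace (weak_topology s E) = topspace E"
proof -
  have "(\<lambda>_. 0) \<in> dual s E"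
    by (auto simp: dual_def)
  then show ?thesis
    unfolding weak_topology_def topology_generated_by_topspace by blast
qed

lemma topspace_Cp:
  "topspace (Cp X) = {f. continuous_map X euclidean f \<and> (\<forall>x. x \<notin> topspace X \<longrightarrow> f x = 0)}"
  by (auto simp: Cp_def)

end

theory Submission
  imports Defs
begin

text \<open>
  Every \<open>V*\<close> set is an \<open>EV*\<close> set, so it suffices to derive \<open>EV*\<close> from discreteness and
  discreteness from \<open>V*\<close>. The weak topology of \<open>C\<^sub>p(X)\<close> is its own topology, because the
  evaluations at points are continuous functionals; so weak compactness is compactness for
  pointwise convergence.

  If \<open>X\<close> is discrete, then \<open>C\<^sub>p(X)\<close> is the full power of the scalar field. An \<open>EV*\<close> set is pointwise
  bounded, as is seen by testing it with the sequence \<open>\<delta>\<^sub>x, 0, 0, \<dots>\<close>; it therefore lies in a product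
  of closed balls, and that product is compact.

  For the converse the test set is the unit ball \<open>A\<close> of bounded continuous functions. It is dense, for
  pointwise convergence, in the ball of all functions bounded by 1, so if its closure in \<open>C\<^sub>p(X)\<close> is
  compact, hence closed among all functions, then the indicator of each point is continuous and \<open>X\<close> is
  discrete. That \<open>A\<close> is a \<open>V*\<close> set rests on \<open>weakly_summable_Cp_finite_support\<close>:
  the functionals of a weakly \<open>p\<close>-summable sequence in the strong dual are all supported by one finite set
  of points. The supremum over \<open>A\<close> is then at most a finite sum of coefficients, each of which is in
  \<open>\<ell>\<^sub>p\<close> as the value at a suitable bump function, and \<open>\<ell>\<^sub>p\<close> is contained in \<open>\<ell>\<^sub>q\<close>.

  The finiteness of the joint support comes from a gliding hump. If the functionals \<open>\<mu>\<^sub>n\<close> charge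
  infinitely many points, choose infinitely many of these with disjoint neighbourhoods, and functions
  \<open>g\<^sub>k\<close> living on these neighbourhoods such that each \<open>g\<^sub>k\<close> is seen by some \<open>\<mu>\<^sub>n\<close>. The partial sums of
  \<open>\<Sum>k. c\<^sub>k g\<^sub>k\<close> are pointwise bounded for every choice of \<open>c\<close>, so \<open>\<mu> \<mapsto> \<Sum>k. c\<^sub>k \<mu>(g\<^sub>k)\<close> is a continuous
  functional on the strong dual. The matrix \<open>\<mu>\<^sub>n(g\<^sub>k)\<close> has finite rows and no zero column, and
  for such a matrix some \<open>c\<close> makes the functional unbounded along \<open>\<mu>\<^sub>n\<close>, contradicting weak summability.

  Compactness of the closed balls of the scalar field is used in the discrete case; stated for normed
  fields with this property, the lemmas treat \<open>real\<close> and \<open>complex\<close> at once.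
\<close>

section \<open>Sequences in \<open>\<ell>\<^sub>p\<close>\<close>

lemma real_of_ereal_ge_one: "1 \<le> p \<Longrightarrow> p \<noteq> \<infinity> \<Longrightarrow> 1 \<le> real_of_ereal p"
  by (cases p) auto

lemma in_lp_tendsto_zero:
  fixes a :: "nat \<Rightarrow> 'k::real_normed_vector"
  assumes "1 \<le> p" "in_lp p a"
  shows "a \<longlonglongrightarrow> 0"
proof (cases "p = \<infinity>")
  case True
  then show ?thesis using assms by (simp add: in_lp_def)
next
  case False
  define r where "r = real_of_ereal p"
  have r: "1 \<le> r" using real_of_ereal_ge_one assms False by (simp add: r_def)
  have "(\<lambda>n. norm (a n) powr r) \<longlonglongrightarrow> 0"
    using assms False by (simp add: in_lp_def r_def summable_LIMSEQ_zero)
  then have "(\<lambda>n. (norm (a n) powr r) powr (1/r)) \<longlonglongrightarrow> 0"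
    by (rule tendsto_zero_powrI[OF _ tendsto_const]) (use r in auto)
  moreover have "(norm (a n) powr r) powr (1/r) = norm (a n)" for n
    using r by (simp add: powr_powr)
  ultimately show ?thesis by (simp add: tendsto_norm_zero_iff)
qed

lemma in_lp_mono:
  fixes a :: "nat \<Rightarrow> 'k::real_normed_vector"
  assumes "1 \<le> p" "p \<le> q" "in_lp p a"
  shows "in_lp q a"
proof (cases "q = \<infinity>")
  case True
  then show ?thesis using in_lp_tendsto_zero assms by (auto simp: in_lp_def)
next
  case False
  then have p: "p \<noteq> \<infinity>" using assms by auto
  have pq: "real_of_ereal p \<le> real_of_ereal q"
    using assms False p by (cases p; cases q) auto
  have "\<forall>\<^sub>F n in sequentially. norm (a n) < 1"
    using in_lp_tendsto_zero[OF assms(1,3)] by (auto simp: tendsto_iff dist_norm)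
  then have "\<forall>\<^sub>F n in sequentially.
      norm (norm (a n) powr real_of_ereal q) \<le> norm (a n) powr real_of_ereal p"
    by eventually_elim (use pq in \<open>auto intro: powr_mono'\<close>)
  moreover have "summable (\<lambda>n. norm (a n) powr real_of_ereal p)"
    using assms p by (simp add: in_lp_def)
  ultimately show ?thesis
    using False by (auto simp: in_lp_def intro: summable_comparison_test_ev)
qed

text \<open>
  A sum over \<open>S\<close> is at most \<open>card S\<close> times its largest term, which gives
  \<open>(\<Sum>y\<in>S. u y) powr q \<le> card S powr q * (\<Sum>y\<in>S. u y powr q)\<close>.
\<close>

lemma in_lp_dominated_by_sum:
  fixes s :: "nat \<Rightarrow> 'k::real_normed_vector" and t :: "'i \<Rightarrow> nat \<Rightarrow> 'l::real_normed_vector"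
  assumes "1 \<le> q" "finite S" and t: "\<And>y. y \<in> S \<Longrightarrow> in_lp q (t y)"
    and le: "\<And>n. norm (s n) \<le> (\<Sum>y\<in>S. norm (t y n))"
  shows "in_lp q s"
proof (cases "q = \<infinity>")
  case True
  have "(\<lambda>n. \<Sum>y\<in>S. norm (t y n)) \<longlonglongrightarrow> 0"
    using t True by (intro tendsto_null_sum) (auto simp: in_lp_def intro: tendsto_norm_zero)
  then show ?thesis
    using True le Lim_null_comparison[of s "\<lambda>n. \<Sum>y\<in>S. norm (t y n)" sequentially]
    by (simp add: in_lp_def)
next
  case False
  define r where "r = real_of_ereal q"
  have r: "1 \<le> r" using real_of_ereal_ge_one assms False by (simp add: r_def)
  have "norm (norm (s n) powr r) \<le> real (card S) powr r * (\<Sum>y\<in>S. norm (t y n) powr r)" for n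
  proof (cases "S = {}")
    case True
    then show ?thesis using le[of n] r by simp
  next
    case nonempty: False
    have "Max ((\<lambda>y. norm (t y n)) ` S) \<in> (\<lambda>y. norm (t y n)) ` S"
      using nonempty \<open>finite S\<close> by (intro Max_in) auto
    then obtain y where y: "y \<in> S" "Max ((\<lambda>y. norm (t y n)) ` S) = norm (t y n)" by auto
    then have max: "norm (t z n) \<le> norm (t y n)" if "z \<in> S" for z
      using that \<open>finite S\<close> by (metis Max_ge finite_imageI imageI)
    have "norm (s n) \<le> real (card S) * norm (t y n)"
      using le[of n] sum_bounded_above[of S "\<lambda>z. norm (t z n)", OF max] by simp
    then have "norm (s n) powr r \<le> (real (card S) * norm (t y n)) powr r"
      using r by (intro powr_mono2) auto
    also have "\<dots> = real (card S) powr r * norm (t y n) powr r"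
      by (simp add: powr_mult)
    also have "norm (t y n) powr r \<le> (\<Sum>y\<in>S. norm (t y n) powr r)"
      using \<open>finite S\<close> y(1) by (intro member_le_sum) auto
    finally show ?thesis by (simp add: mult_left_mono)
  qed
  moreover have "summable (\<lambda>n. real (card S) powr r * (\<Sum>y\<in>S. norm (t y n) powr r))"
    using t False by (intro summable_mult summable_sum) (auto simp: in_lp_def r_def)
  ultimately show ?thesis
    using False summable_comparison_test'[where N = 0] unfolding in_lp_def r_def by (metis (no_types, lifting))
qed

section \<open>A row-finite matrix is unbounded on some sequence\<close>

text \<open>
  Forward substitution: the coefficient \<open>m\<close> is chosen so that row \<open>m\<close> of the triangular matrix
  \<open>r\<close>, applied to the coefficients up to \<open>m\<close>, gives \<open>m\<close>. This requires \<open>r m m \<noteq> 0\<close>; the other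
  indices will not matter, as their rows are not used.
\<close>

fun diagonal_coeff :: "(nat \<Rightarrow> nat \<Rightarrow> 'k::field) \<Rightarrow> nat \<Rightarrow> 'k" where
  "diagonal_coeff r m = (of_nat m - (\<Sum>k<m. diagonal_coeff r k * r m k)) / r m m"

declare diagonal_coeff.simps [simp del]

text \<open>
  Since no column vanishes, the positions of the last nonzero entries of the rows are unbounded;
  one row for each such position makes a triangular system, in which the sums can be prescribed.
\<close>

lemma row_finite_matrix_unbounded:
  fixes b :: "nat \<Rightarrow> nat \<Rightarrow> 'k::real_normed_field"
  assumes row: "\<And>n. \<exists>N. \<forall>k\<ge>N. b n k = 0" and col: "\<And>k. \<exists>n. b n k \<noteq> 0"
  shows "\<exists>c. \<forall>M. \<exists>n. real M \<le> norm (\<Sum>k. c k * b n k)"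
proof -
  define I where "I = {m. \<exists>n. b n m \<noteq> 0 \<and> (\<forall>k>m. b n k = 0)}"
  have "\<forall>m\<in>I. \<exists>n. b n m \<noteq> 0 \<and> (\<forall>k>m. b n k = 0)" by (simp add: I_def)
  then obtain row_of where row_of: "\<And>m. m \<in> I \<Longrightarrow> b (row_of m) m \<noteq> 0 \<and> (\<forall>k>m. b (row_of m) k = 0)"
    by metis
  define c where "c = diagonal_coeff (\<lambda>m. b (row_of m))"
  have unbounded: "\<exists>m\<in>I. M \<le> m" for M
  proof -
    obtain n where n: "b n M \<noteq> 0" using col by blast
    obtain N where N: "\<forall>k\<ge>N. b n k = 0" using row by blast
    let ?J = "{k. b n k \<noteq> 0}"
    have fin: "finite ?J"
      by (rule finite_subset[of _ "{..<N}"]) (use N in \<open>auto simp: not_le[symmetric]\<close>)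
    have "Max ?J \<in> ?J" using n by (intro Max_in fin) auto
    moreover have "b n k = 0" if "k > Max ?J" for k
      using that Max_ge[OF fin, of k] by fastforce
    ultimately have "Max ?J \<in> I" unfolding I_def by blast
    moreover have "M \<le> Max ?J" using n fin by simp
    ultimately show ?thesis by blast
  qed
  have "(\<Sum>k. c k * b (row_of m) k) = of_nat m" if m: "m \<in> I" for m
  proof -
    have "(\<Sum>k. c k * b (row_of m) k) = (\<Sum>k\<le>m. c k * b (row_of m) k)"
      using row_of[OF m] by (intro suminf_finite) (auto simp: not_le)
    also have "\<dots> = (\<Sum>k<m. c k * b (row_of m) k) + c m * b (row_of m) m"
      by (simp add: lessThan_Suc_atMost[symmetric])
    also have "c m = (of_nat m - (\<Sum>k<m. c k * b (row_of m) k)) / b (row_of m) m"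
      unfolding c_def by (rule diagonal_coeff.simps)
    finally show ?thesis using row_of[OF m] by simp
  qed
  then have "\<forall>M. \<exists>n. real M \<le> norm (\<Sum>k. c k * b n k)"
    using unbounded by (metis norm_of_nat of_nat_mono)
  then show ?thesis by blast
qed

section \<open>Linear structure and basic neighbourhoods of \<open>C\<^sub>p(X)\<close>\<close>

lemma zero_in_Cp: "0 \<in> topspace (Cp X)"
  by (auto simp: topspace_Cp zero_fun_def)

lemma Cp_add: "f \<in> topspace (Cp X) \<Longrightarrow> g \<in> topspace (Cp X) \<Longrightarrow>
    f + g \<in> topspace (Cp X :: ('a \<Rightarrow> 'k::real_normed_field) topology)"
  by (auto simp: topspace_Cp plus_fun_def continuous_map_atin tendsto_add)

lemma Cp_scale: "f \<in> topspace (Cp X) \<Longrightarrow>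
    fscale c f \<in> topspace (Cp X :: ('a \<Rightarrow> 'k::real_normed_field) topology)"
  by (auto simp: topspace_Cp fscale_def continuous_map_atin tendsto_mult_left)

lemma Cp_linear_combination:
  fixes f :: "'i \<Rightarrow> 'a \<Rightarrow> 'k::real_normed_field"
  assumes "finite I" "\<And>i. i \<in> I \<Longrightarrow> f i \<in> topspace (Cp X)"
  shows "(\<lambda>x. \<Sum>i\<in>I. c i * f i x) \<in> topspace (Cp X)"
  using assms by (auto simp: topspace_Cp continuous_map_atin intro!: tendsto_sum tendsto_mult_left)

lemma continuous_map_Cp_coordinate:
  "continuous_map (Cp X) euclidean (\<lambda>f :: 'a \<Rightarrow> 'k::real_normed_field. f x)"
  unfolding Cp_def by (intro continuous_map_from_subtopology continuous_map_product_coordinates[of x UNIV "\<lambda>_. euclidean"]) simp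

lemma openin_pointwise_box:
  fixes f :: "'a \<Rightarrow> 'k::topological_space"
  assumes "openin (product_topology (\<lambda>_. euclidean) UNIV) W" "f \<in> W"
  obtains U where "finite {i. U i \<noteq> UNIV}" "\<And>i. open (U i)" "f \<in> Pi UNIV U" "Pi UNIV U \<subseteq> W"
  using assms unfolding openin_product_topology_alt by (auto simp: PiE_def)

lemma openin_Cp_basic:
  fixes f :: "'a \<Rightarrow> 'k::real_normed_field"
  assumes "openin (Cp X) V" "f \<in> V"
  obtains F e where "finite F" "e > 0"
    "\<And>g. g \<in> topspace (Cp X) \<Longrightarrow> (\<And>x. x \<in> F \<Longrightarrow> norm (g x - f x) < e) \<Longrightarrow> g \<in> V"
proof -
  obtain W where W: "openin (product_topology (\<lambda>_. euclidean) UNIV) W" "V = W \<inter> topspace (Cp X)"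
    using assms unfolding Cp_def openin_subtopology by (auto simp: topspace_Cp[unfolded Cp_def])
  have "f \<in> W" using assms W by blast
  with W(1) obtain U where U: "finite {i. U i \<noteq> UNIV}" "\<And>i. open (U i)" "f \<in> Pi UNIV U" "Pi UNIV U \<subseteq> W"
    by (rule openin_pointwise_box) (rule that; assumption)
  have "\<exists>e>0. ball (f i) e \<subseteq> U i" for i
    using U(2)[of i] U(3) open_contains_ball by blast
  then obtain e where e: "\<And>i. e i > 0" "\<And>i. ball (f i) (e i) \<subseteq> U i" by metis
  define F where "F = {i. U i \<noteq> UNIV}"
  define d where "d = Min (insert 1 (e ` F))"
  have F: "finite F" using U by (simp add: F_def)
  have d: "d > 0" "\<And>i. i \<in> F \<Longrightarrow> d \<le> e i" using F e by (auto simp: d_def)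
  show thesis
  proof (rule that[OF F d(1)])
    fix g assume g: "g \<in> topspace (Cp X)" "\<And>x. x \<in> F \<Longrightarrow> norm (g x - f x) < d"
    have "g i \<in> U i" for i
    proof (cases "i \<in> F")
      case True
      then have "norm (g i - f i) < e i" using g(2) d(2) by fastforce
      then show ?thesis using e(2)[of i] by (auto simp: dist_norm norm_minus_commute)
    qed (simp add: F_def)
    then show "g \<in> V" using U(4) W(2) g(1) by blast
  qed
qed

section \<open>Bump functions on Tychonoff spaces\<close>

lemma Cp_bump:
  assumes X: "Tychonoff_space X" and "finite F" "openin X U" "x \<in> U"
  shows "\<exists>g :: 'a \<Rightarrow> 'k::real_normed_field. g \<in> topspace (Cp X) \<and> g x = 1
           \<and> (\<forall>y. y \<notin> U \<or> y \<in> F - {x} \<longrightarrow> g y = 0) \<and> (\<forall>y. norm (g y) \<le> 1)"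
proof -
  let ?C = "(topspace X - U) \<union> ((F - {x}) \<inter> topspace X)"
  have UX: "U \<subseteq> topspace X" using assms by (simp add: openin_subset)
  have "closedin X ((F - {x}) \<inter> topspace X)"
    using assms unfolding Tychonoff_space_def t1_space_closedin_finite
    by (meson finite_Diff finite_Int inf_le2)
  then have "closedin X ?C" using assms by (intro closedin_Un) auto
  moreover have "x \<in> topspace X - ?C" using UX assms by blast
  ultimately obtain f :: "'a \<Rightarrow> real"
    where f: "continuous_map X (top_of_set {0..1}) f" "f x = 0" "f ` ?C \<subseteq> {1}"
    using X unfolding Tychonoff_space_def completely_regular_space_def by meson
  define g :: "'a \<Rightarrow> 'k" where "g y = (if y \<in> topspace X then of_real (1 - f y) else 0)" for y
  have cont: "continuous_map X euclidean f" and le: "\<And>y. y \<in> topspace X \<Longrightarrow> 0 \<le> f y \<and> f y \<le> 1"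
    using f(1) by (auto simp: continuous_map_in_subtopology)
  have "continuous_map X euclidean (\<lambda>y. of_real (1 - f y) :: 'k)"
    using cont unfolding continuous_map_atin by (auto simp del: of_real_diff intro!: tendsto_of_real tendsto_diff)
  then have "continuous_map X euclidean g"
    by (rule continuous_map_eq) (simp add: g_def)
  then have "g \<in> topspace (Cp X)" by (auto simp: topspace_Cp g_def)
  moreover have "g x = 1" using UX assms f by (auto simp: g_def)
  moreover have "g y = 0" if "y \<notin> U \<or> y \<in> F - {x}" for y
  proof (cases "y \<in> topspace X")
    case True
    then have "f y = 1" using f(3) that by blast
    then show ?thesis by (simp add: g_def)
  qed (simp add: g_def)
  moreover have "norm (g y) \<le> 1" for y
    using le[of y] by (auto simp: g_def simp del: of_real_diff)
  ultimately show ?thesis by blast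
qed

text \<open>
  A function separating two points of \<open>S\<close> splits \<open>V\<close> into two overlapping open parts; one of
  them keeps infinitely many points of \<open>S\<close>, and leaves room for a neighbourhood of a point of \<open>S\<close>.
\<close>

lemma Tychonoff_split_off_open:
  assumes X: "Tychonoff_space X" and V: "openin X V" "infinite (S \<inter> V)"
  shows "\<exists>V'. openin X V' \<and> infinite (S \<inter> V') \<and> V' \<subseteq> V \<and>
           (\<exists>U x. openin X U \<and> U \<subseteq> V \<and> x \<in> S \<inter> U \<and> U \<inter> V' = {})"
proof -
  obtain a where a: "a \<in> S \<inter> V" using infinite_imp_nonempty[OF V(2)] by blast
  obtain b where b: "b \<in> S \<inter> V" "b \<noteq> a"
    using infinite_imp_nonempty[OF infinite_remove[OF V(2)], of a] by blast
  have in_X: "a \<in> topspace X" "b \<in> topspace X" using a b V openin_subset by fastforce+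
  then have "closedin X {b}" using X by (simp add: Tychonoff_space_def t1_space_closedin_singleton)
  then obtain f :: "'a \<Rightarrow> real"
    where f: "continuous_map X (top_of_set {0..1}) f" "f a = 0" "f ` {b} \<subseteq> {1}"
    using X in_X b unfolding Tychonoff_space_def completely_regular_space_def
    by (metis DiffI singletonD)
  then have cont: "continuous_map X euclideanreal f" by (simp add: continuous_map_in_subtopology)
  have opn: "openin X {y \<in> V. f y \<in> W}" if "open W" for W
    using openin_continuous_map_preimage_gen[OF cont V(1), of W] that by simp
  let ?hi = "{y \<in> V. f y \<in> {1/3<..}}" and ?lo = "{y \<in> V. f y \<in> {..<2/3}}"
  have split: "S \<inter> V = (S \<inter> ?hi) \<union> (S \<inter> ?lo)" by fastforce
  have "infinite ((S \<inter> ?hi) \<union> (S \<inter> ?lo))" using V(2) by (subst split[symmetric])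
  then consider "infinite (S \<inter> ?hi)" | "infinite (S \<inter> ?lo)" unfolding finite_Un by blast
  then show ?thesis
  proof cases
    case 1
    then show ?thesis
      using opn[of "{1/3<..}"] opn[of "{..<1/3}"] a f
      by (intro exI[of _ ?hi] conjI exI[of _ "{y \<in> V. f y \<in> {..<1/3}}"] exI[of _ a]) auto
  next
    case 2
    then show ?thesis
      using opn[of "{..<2/3}"] opn[of "{2/3<..}"] b f
      by (intro exI[of _ ?lo] conjI exI[of _ "{y \<in> V. f y \<in> {2/3<..}}"] exI[of _ b]) auto
  qed
qed

lemma Tychonoff_disjoint_opens:
  assumes X: "Tychonoff_space X" and S: "infinite S" "S \<subseteq> topspace X"
  obtains U :: "nat \<Rightarrow> 'a set" and x :: "nat \<Rightarrow> 'a"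
  where "\<And>k. openin X (U k)" "\<And>k. x k \<in> S \<inter> U k" "\<And>j k. j \<noteq> k \<Longrightarrow> U j \<inter> U k = {}"
proof -
  have "\<exists>V. \<forall>n. (openin X (V n) \<and> infinite (S \<inter> V n)) \<and> (V (Suc n) \<subseteq> V n \<and>
           (\<exists>U x. openin X U \<and> U \<subseteq> V n \<and> x \<in> S \<inter> U \<and> U \<inter> V (Suc n) = {}))"
  proof (rule dependent_nat_choice)
    show "\<exists>V. openin X V \<and> infinite (S \<inter> V)"
      using S by (intro exI[of _ "topspace X"]) (simp add: Int_absorb2)
  next
    fix V :: "'a set" and n :: nat
    assume "openin X V \<and> infinite (S \<inter> V)"
    then show "\<exists>V'. (openin X V' \<and> infinite (S \<inter> V')) \<and> (V' \<subseteq> V \<and>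
           (\<exists>U x. openin X U \<and> U \<subseteq> V \<and> x \<in> S \<inter> U \<and> U \<inter> V' = {}))"
      using Tychonoff_split_off_open[OF X] by simp
  qed
  then obtain V where all: "\<forall>n. (openin X (V n) \<and> infinite (S \<inter> V n)) \<and> (V (Suc n) \<subseteq> V n \<and>
           (\<exists>U x. openin X U \<and> U \<subseteq> V n \<and> x \<in> S \<inter> U \<and> U \<inter> V (Suc n) = {}))"
    by (elim exE)
  have V: "V (Suc n) \<subseteq> V n" for n using all by simp
  have ex: "\<exists>U x. openin X U \<and> U \<subseteq> V n \<and> x \<in> S \<inter> U \<and> U \<inter> V (Suc n) = {}" for n
    using all by simp
  obtain U x where U: "\<And>n. openin X (U n)" "\<And>n. U n \<subseteq> V n" "\<And>n. x n \<in> S \<inter> U n"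
      "\<And>n. U n \<inter> V (Suc n) = {}"
    using ex by metis
  have less: "U j \<inter> U k = {}" if "j < k" for j k
  proof -
    have "V k \<subseteq> V (Suc j)" by (rule lift_Suc_antimono_le[of V, OF V]) (use that in simp)
    then show ?thesis using U(2)[of k] U(4)[of j] by blast
  qed
  then have "U j \<inter> U k = {}" if "j \<noteq> k" for j k
    using that by (metis Int_commute linorder_neqE_nat)
  with U show ?thesis by (intro that[of U x]) simp_all
qed

section \<open>The dual of \<open>C\<^sub>p(X)\<close>\<close>

lemma dual_scale:
  fixes \<mu> :: "'v::ab_group_add \<Rightarrow> 'k::real_normed_field"
  assumes "\<mu> \<in> dual s E"
  shows "fscale c \<mu> \<in> dual s E"
  using assms
  by (auto simp: dual_def fscale_def algebra_simps continuous_map_atin tendsto_mult_left)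

lemma dual_zero: "0 \<in> dual s E"
  by (auto simp: dual_def zero_fun_def)

text \<open>
  A \<open>dual\<close> element is additive only on the space, so the linear combinations must be known to stay in it.
\<close>

lemma dual_linear_combination:
  fixes f :: "'i \<Rightarrow> 'a \<Rightarrow> 'k::real_normed_field"
  assumes \<mu>: "\<mu> \<in> dual fscale (Cp X)" and "finite I" "\<And>i. i \<in> I \<Longrightarrow> f i \<in> topspace (Cp X)"
  shows "\<mu> (\<lambda>x. \<Sum>i\<in>I. c i * f i x) = (\<Sum>i\<in>I. c i * \<mu> (f i))"
  using assms(2,3)
proof (induction I)
  case empty
  have "\<forall>f\<in>topspace (Cp X). \<mu> (fscale 0 f) = 0 * \<mu> f" using \<mu> by (simp add: dual_def)
  then have "\<mu> (fscale 0 0) = 0" using zero_in_Cp[of X] by (metis mult_zero_left)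
  then show ?case by (simp add: fscale_def)
next
  case (insert i I)
  let ?s = "\<lambda>x. \<Sum>i\<in>I. c i * f i x"
  have "?s \<in> topspace (Cp X)" "fscale (c i) (f i) \<in> topspace (Cp X)"
    using insert Cp_linear_combination[of I f X c] Cp_linear_combination[of "{i}" f X c]
    by (auto simp: fscale_def)
  then have "\<mu> (fscale (c i) (f i) + ?s) = c i * \<mu> (f i) + \<mu> ?s"
    using \<mu> insert.prems by (auto simp: dual_def)
  moreover have "fscale (c i) (f i) + ?s = (\<lambda>x. \<Sum>i\<in>insert i I. c i * f i x)"
    using insert.hyps by (auto simp: fscale_def plus_fun_def)
  ultimately show ?case using insert by simp
qed

text \<open>Like all elements of a \<open>dual\<close>, an evaluation is 0 outside the space.\<close>

definition evaluation :: "'a topology \<Rightarrow> 'a \<Rightarrow> ('a \<Rightarrow> 'k::real_normed_field) \<Rightarrow> 'k" where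
  "evaluation X x f = (if f \<in> topspace (Cp X) then f x else 0)"

lemma evaluation_in_dual: "evaluation X x \<in> dual fscale (Cp X :: ('a \<Rightarrow> 'k::real_normed_field) topology)"
proof -
  have "continuous_map (Cp X) euclidean (evaluation X x :: ('a \<Rightarrow> 'k) \<Rightarrow> 'k)"
    by (rule continuous_map_eq[OF continuous_map_Cp_coordinate]) (simp add: evaluation_def)
  then show ?thesis
    unfolding dual_def
    by (auto simp: evaluation_def Cp_add Cp_scale) (auto simp: fscale_def)
qed

text \<open>
  A continuous functional is bounded by 1 on the functions that are small on some finite set \<open>F\<close>,
  hence vanishes, by homogeneity, on those that are zero on \<open>F\<close>.
\<close>

lemma dual_Cp_finite_support:
  fixes \<mu> :: "('a \<Rightarrow> 'k::real_normed_field) \<Rightarrow> 'k"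
  assumes X: "Tychonoff_space X" and \<mu>: "\<mu> \<in> dual fscale (Cp X)"
  shows "\<exists>a. finite {x. a x \<noteq> 0} \<and> {x. a x \<noteq> 0} \<subseteq> topspace X
    \<and> (\<forall>f\<in>topspace (Cp X). \<mu> f = (\<Sum>x | a x \<noteq> 0. a x * f x))"
proof -
  have hom: "\<mu> (fscale c f) = c * \<mu> f" if "f \<in> topspace (Cp X)" for c f
    using \<mu> that by (simp add: dual_def)
  have cont: "continuous_map (Cp X) euclidean \<mu>" using \<mu> by (simp add: dual_def)
  have \<mu>0: "\<mu> 0 = 0" using hom[OF zero_in_Cp, of 0] by (simp add: fscale_def zero_fun_def)
  have "openin (Cp X) {f \<in> topspace (Cp X). \<mu> f \<in> ball 0 1}"
    by (rule openin_continuous_map_preimage[OF cont]) simp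
  then obtain G e where G: "finite G" "e > 0"
    "\<And>g. g \<in> topspace (Cp X) \<Longrightarrow> (\<And>x. x \<in> G \<Longrightarrow> norm (g x) < e) \<Longrightarrow> norm (\<mu> g) < 1"
    by (rule openin_Cp_basic[where f = 0]) (use \<mu>0 zero_in_Cp in \<open>auto simp: zero_fun_def\<close>)
  define F where "F = G \<inter> topspace X"
  have F: "finite F" "F \<subseteq> topspace X" using G by (auto simp: F_def)
  have vanish: "\<mu> f = 0" if f: "f \<in> topspace (Cp X)" "\<And>x. x \<in> F \<Longrightarrow> f x = 0" for f
  proof (rule ccontr)
    assume nz: "\<mu> f \<noteq> 0"
    have "f x = 0" if "x \<in> G" for x
      using f that by (cases "x \<in> topspace X") (auto simp: F_def topspace_Cp)
    then have "norm (\<mu> (fscale (1 / \<mu> f) f)) < 1"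
      using G(2) f(1) by (intro G(3) Cp_scale) (auto simp: fscale_def)
    then show False using hom[OF f(1)] nz by simp
  qed
  have "\<exists>g :: 'a \<Rightarrow> 'k. g \<in> topspace (Cp X) \<and> g x = 1 \<and> (\<forall>y\<in>F - {x}. g y = 0)" if "x \<in> F" for x
    using Cp_bump[OF X F(1) openin_topspace, of x, where ?'k = 'k] that F(2) by blast
  then obtain g :: "'a \<Rightarrow> 'a \<Rightarrow> 'k" where g: "\<And>x. x \<in> F \<Longrightarrow> g x \<in> topspace (Cp X)"
      "\<And>x. x \<in> F \<Longrightarrow> g x x = 1" "\<And>x y. x \<in> F \<Longrightarrow> y \<in> F \<Longrightarrow> y \<noteq> x \<Longrightarrow> g x y = 0"
    by (metis DiffI singletonD)
  define a where "a x = (if x \<in> F then \<mu> (g x) else 0)" for x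
  have supp: "{x. a x \<noteq> 0} \<subseteq> F" by (auto simp: a_def)
  have "\<mu> f = (\<Sum>x | a x \<noteq> 0. a x * f x)" if f: "f \<in> topspace (Cp X)" for f
  proof -
    let ?s = "\<lambda>y. \<Sum>x\<in>F. f x * g x y"
    have s: "?s \<in> topspace (Cp X)" by (rule Cp_linear_combination) (use F g in auto)
    have sy: "?s y = f y" if "y \<in> F" for y
    proof -
      have "?s y = (\<Sum>x\<in>F. if x = y then f x else 0)"
        using that g by (intro sum.cong) auto
      then show ?thesis using F that by simp
    qed
    have "f + fscale (-1) ?s \<in> topspace (Cp X)" using f s by (intro Cp_add Cp_scale)
    then have "\<mu> (f + fscale (-1) ?s) = 0"
      by (rule vanish) (use sy in \<open>auto simp: fscale_def\<close>)
    moreover have "\<mu> (f + fscale (-1) ?s) = \<mu> f + \<mu> (fscale (-1) ?s)"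
      using \<mu> f Cp_scale[OF s] by (simp add: dual_def)
    ultimately have "\<mu> f = \<mu> ?s" using hom[OF s, of "-1"] by simp
    also have "\<dots> = (\<Sum>x\<in>F. f x * \<mu> (g x))" using dual_linear_combination[OF \<mu> F(1) g(1)] by simp
    also have "\<dots> = (\<Sum>x\<in>F. a x * f x)" by (intro sum.cong) (auto simp: a_def)
    also have "\<dots> = (\<Sum>x | a x \<noteq> 0. a x * f x)"
      using F supp by (intro sum.mono_neutral_right) auto
    finally show ?thesis .
  qed
  then show ?thesis
    using supp F by (intro exI[of _ a]) (auto intro: finite_subset)
qed

text \<open>
  The topology of \<open>C\<^sub>p(X)\<close> is the coarsest one for which the evaluations are continuous, and these
  belong to the dual.
\<close>

lemma weak_topology_Cp:
  "weak_topology fscale (Cp X) = (Cp X :: ('a \<Rightarrow> 'k::real_normed_field) topology)"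
proof (rule topology_eq[THEN iffD2], intro allI iffI)
  let ?w = "weak_topology fscale (Cp X :: ('a \<Rightarrow> 'k) topology)"
  fix U :: "('a \<Rightarrow> 'k) set"
  show "openin (Cp X) U" if "openin ?w U"
  proof -
    have "openin (Cp X) V" if "V \<in> {{f \<in> topspace (Cp X). \<phi> f \<in> W} | \<phi> W. \<phi> \<in> dual fscale (Cp X) \<and> open W}"
      for V :: "('a \<Rightarrow> 'k) set"
      using that by (auto simp: dual_def intro!: openin_continuous_map_preimage[where Y = euclidean])
    then show ?thesis
      using that unfolding weak_topology_def openin_topology_generated_by_iff
      by (metis (no_types, lifting) generate_topology_on_coarsest istopology_openin)
  qed
  show "openin ?w U" if U: "openin (Cp X) U"
  proof -
    have "continuous_map ?w euclidean (\<lambda>f. f x)" for x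
    proof -
      have "openin ?w {f \<in> topspace (Cp X). f x \<in> W}" if "open W" for W :: "'k set"
      proof -
        have "{f \<in> topspace (Cp X). f x \<in> W} = {f \<in> topspace (Cp X). evaluation X x f \<in> W}"
          by (auto simp: evaluation_def)
        then show ?thesis
          unfolding weak_topology_def
          using evaluation_in_dual[of X x, where ?'k = 'k] that
          by (intro topology_generated_by_Basis CollectI exI[of _ "evaluation X x"] exI[of _ W]) simp
      qed
      then show ?thesis by (simp add: continuous_map_def)
    qed
    then have "continuous_map ?w (Cp X) (\<lambda>f. f)"
      unfolding Cp_def continuous_map_in_subtopology
      by (auto simp: continuous_map_componentwise_UNIV topspace_Cp[unfolded Cp_def])
    then have "openin ?w {f \<in> topspace ?w. f \<in> U}"
      using U by (rule openin_continuous_map_preimage)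
    moreover have "{f \<in> topspace ?w. f \<in> U} = U" using openin_subset[OF U] by auto
    ultimately show ?thesis by simp
  qed
qed

section \<open>Functionals on the strong dual\<close>

lemma tvs_bounded_Cp:
  fixes B :: "('a \<Rightarrow> 'k::real_normed_field) set"
  assumes B: "B \<subseteq> topspace (Cp X)" and bd: "\<And>x. bdd_above ((\<lambda>f. norm (f x)) ` B)"
  shows "tvs_bounded fscale (Cp X) B"
  unfolding tvs_bounded_def
proof (intro conjI allI impI B)
  fix U :: "('a \<Rightarrow> 'k) set" assume "zero_nbhd (Cp X) U"
  then obtain V where V: "openin (Cp X) V" "0 \<in> V" "V \<subseteq> U" by (auto simp: zero_nbhd_def)
  obtain F e where F: "finite F" "e > 0"
    "\<And>g. g \<in> topspace (Cp X) \<Longrightarrow> (\<And>x. x \<in> F \<Longrightarrow> norm (g x) < e) \<Longrightarrow> g \<in> V"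
    using openin_Cp_basic[OF V(1,2)] by (metis diff_zero zero_fun_apply)
  obtain M where M: "\<And>x f. f \<in> B \<Longrightarrow> norm (f x) \<le> M x"
    using bd unfolding bdd_above_def by (metis imageI)
  define r where "r = Max (insert 1 ((\<lambda>x. (M x + 1) / e) ` F))"
  have r: "1 \<le> r" "\<And>x. x \<in> F \<Longrightarrow> (M x + 1) / e \<le> r" unfolding r_def using F(1) by (auto intro!: Max_ge)
  show "\<exists>r>0. \<forall>c. r \<le> norm c \<longrightarrow> B \<subseteq> fscale c ` U"
  proof (intro exI[of _ r] conjI allI impI subsetI)
    show "0 < r" using r(1) by simp
    fix c :: 'k and f assume c: "r \<le> norm c" and f: "f \<in> B"
    then have "c \<noteq> 0" using r(1) by auto
    have "fscale (1 / c) f \<in> V"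
    proof (rule F(3))
      show "fscale (1 / c) f \<in> topspace (Cp X)" using B f by (auto intro: Cp_scale)
      fix x assume "x \<in> F"
      then have "M x + 1 \<le> norm c * e" using r(2)[of x] c F(2) by (simp add: field_simps) (smt (verit) mult_right_mono mult.commute)
      then have "norm (f x) < norm c * e" using M[OF f, of x] by simp
      then show "norm (fscale (1 / c) f x) < e"
        using \<open>c \<noteq> 0\<close> by (simp add: fscale_def norm_mult norm_divide field_simps)
    qed
    moreover have "f = fscale c (fscale (1 / c) f)" using \<open>c \<noteq> 0\<close> by (simp add: fscale_def)
    ultimately show "f \<in> fscale c ` U" using V(3) by blast
  qed
qed

text \<open>
  The bound says that \<open>\<Phi>\<close> is at most 1 in modulus on the polar of the bounded set \<open>B\<close>, and such a polar is a
  neighbourhood of 0 in the strong topology. The sets \<open>B\<close> used below are a single function and the set of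
  partial sums of a series.
\<close>

lemma strong_dual_functional:
  fixes \<Phi> :: "(('a \<Rightarrow> 'k::real_normed_field) \<Rightarrow> 'k) \<Rightarrow> 'k"
  assumes B: "B \<subseteq> topspace (Cp X)" "\<And>x. bdd_above ((\<lambda>f. norm (f x)) ` B)"
    and le: "\<And>\<mu>. \<mu> \<in> dual fscale (Cp X) \<Longrightarrow> \<exists>f\<in>B. norm (\<Phi> \<mu>) \<le> norm (\<mu> f)"
    and add: "\<And>\<mu> \<psi>. \<mu> \<in> dual fscale (Cp X) \<Longrightarrow> \<psi> \<in> dual fscale (Cp X) \<Longrightarrow> \<Phi> (\<mu> + \<psi>) = \<Phi> \<mu> + \<Phi> \<psi>"
    and scale: "\<And>c \<mu>. \<mu> \<in> dual fscale (Cp X) \<Longrightarrow> \<Phi> (fscale c \<mu>) = c * \<Phi> \<mu>"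
  shows "(\<lambda>\<mu>. if \<mu> \<in> dual fscale (Cp X) then \<Phi> \<mu> else 0) \<in> dual fscale (strong_topology fscale (Cp X))"
    (is "?\<Psi> \<in> _")
proof -
  let ?D = "dual fscale (Cp X) :: (('a \<Rightarrow> 'k) \<Rightarrow> 'k) set"
  have "openin (strong_topology fscale (Cp X)) {\<mu> \<in> ?D. ?\<Psi> \<mu> \<in> W}" if W: "open W" for W
    unfolding openin_strong_topology
  proof (intro conjI ballI)
    fix \<mu> assume "\<mu> \<in> {\<mu> \<in> ?D. ?\<Psi> \<mu> \<in> W}"
    then have \<mu>: "\<mu> \<in> ?D" "\<Phi> \<mu> \<in> W" by auto
    then obtain e where e: "e > 0" "ball (\<Phi> \<mu>) e \<subseteq> W" using W open_contains_ball by blast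
    (* A functional in the polar of c B is at most e/2 in modulus on B. *)
    define c :: 'k where "c = of_real (2 / e)"
    have c: "norm c = 2 / e" "c \<noteq> 0" using e(1) by (auto simp: c_def norm_divide)
    have "tvs_bounded fscale (Cp X) (fscale c ` B)"
    proof (rule tvs_bounded_Cp)
      show "fscale c ` B \<subseteq> topspace (Cp X)" using B(1) Cp_scale by blast
      fix x
      obtain M where "\<And>f. f \<in> B \<Longrightarrow> norm (f x) \<le> M" using B(2)[of x] by (auto simp: bdd_above_def)
      then show "bdd_above ((\<lambda>f. norm (f x)) ` fscale c ` B)"
        by (intro bdd_aboveI[of _ "norm c * M"]) (auto simp: fscale_def norm_mult mult_left_mono)
    qed
    moreover have "\<mu> + \<psi> \<in> {\<mu> \<in> ?D. ?\<Psi> \<mu> \<in> W}" if \<psi>: "\<psi> \<in> polar fscale (Cp X) (fscale c ` B)" for \<psi>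
    proof -
      have \<psi>D: "\<psi> \<in> ?D" and small: "\<And>f. f \<in> B \<Longrightarrow> norm (\<psi> (fscale c f)) \<le> 1"
        using \<psi> by (auto simp: polar_def)
      obtain f where f: "f \<in> B" "norm (\<Phi> \<psi>) \<le> norm (\<psi> f)" using le[OF \<psi>D] by blast
      have "\<psi> (fscale c f) = c * \<psi> f" using \<psi>D f(1) B(1) by (auto simp: dual_def)
      then have "2 / e * norm (\<psi> f) \<le> 1" using small[OF f(1)] c by (simp add: norm_mult)
      then have "norm (\<Phi> \<psi>) < e" using f(2) e(1) by (simp add: field_simps)
      then have "\<Phi> (\<mu> + \<psi>) \<in> W" using e(2) add[OF \<mu>(1) \<psi>D] by (auto simp: dist_norm)
      then show ?thesis using dual_add[OF \<mu>(1) \<psi>D] by simp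
    qed
    ultimately show "\<exists>B. tvs_bounded fscale (Cp X) B \<and>
        (\<lambda>\<psi>. \<mu> + \<psi>) ` polar fscale (Cp X) B \<subseteq> {\<mu> \<in> ?D. ?\<Psi> \<mu> \<in> W}"
      by blast
  qed auto
  then have "continuous_map (strong_topology fscale (Cp X)) euclidean ?\<Psi>"
    by (simp add: continuous_map_def)
  then show ?thesis
    unfolding dual_def[of fscale "strong_topology fscale (Cp X)"]
    by (auto simp: add scale dual_add dual_scale)
qed

lemma weakly_summableD:
  "weakly_summable p s F x \<Longrightarrow> \<phi> \<in> dual s F \<Longrightarrow> in_lp p (\<lambda>n. \<phi> (x n))"
  by (simp add: weakly_summable_def)

lemma weakly_summable_Cp_evaluation:
  fixes \<mu> :: "nat \<Rightarrow> ('a \<Rightarrow> 'k::real_normed_field) \<Rightarrow> 'k"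
  assumes "weakly_summable p fscale (strong_topology fscale (Cp X)) \<mu>" "f \<in> topspace (Cp X)"
  shows "in_lp p (\<lambda>n. \<mu> n f)"
proof -
  have D: "\<mu> n \<in> dual fscale (Cp X)" for n using assms(1) by (auto simp: weakly_summable_def)
  have "(\<lambda>\<mu>. if \<mu> \<in> dual fscale (Cp X) then \<mu> f else 0) \<in> dual fscale (strong_topology fscale (Cp X))"
    by (rule strong_dual_functional[where B = "{f}"]) (use assms(2) in \<open>auto simp: fscale_def\<close>)
  from weakly_summableD[OF assms(1) this] show ?thesis using D by simp
qed

text \<open>
  At each point at most one \<open>g k\<close> is nonzero. Hence a functional, having finite support, vanishes on almost all
  \<open>g k\<close>; and the partial sums of the series take at most two values at each point, so they form a bounded set
  for every sequence \<open>c\<close>, no matter how fast it grows.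
\<close>

lemma disjoint_series_functional:
  fixes g :: "nat \<Rightarrow> 'a \<Rightarrow> 'k::real_normed_field"
  assumes X: "Tychonoff_space X"
    and g: "\<And>k. g k \<in> topspace (Cp X)" and disj: "\<And>j k y. j \<noteq> k \<Longrightarrow> g j y = 0 \<or> g k y = 0"
  shows "\<mu> \<in> dual fscale (Cp X) \<Longrightarrow> \<exists>N. \<forall>k\<ge>N. \<mu> (g k) = 0"
    and "(\<lambda>\<mu>. if \<mu> \<in> dual fscale (Cp X) then \<Sum>k. c k * \<mu> (g k) else 0)
           \<in> dual fscale (strong_topology fscale (Cp X))"
proof -
  show ev: "\<exists>N. \<forall>k\<ge>N. \<mu> (g k) = 0" if "\<mu> \<in> dual fscale (Cp X)" for \<mu>
  proof -
    obtain a where a: "finite {x. a x \<noteq> 0}"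
      and rep: "\<And>f. f \<in> topspace (Cp X) \<Longrightarrow> \<mu> f = (\<Sum>x | a x \<noteq> 0. a x * f x)"
      using dual_Cp_finite_support[OF X \<open>\<mu> \<in> _\<close>] by blast
    have one: "finite {k. g k y \<noteq> 0}" for y
    proof (cases "\<exists>j. g j y \<noteq> 0")
      case True
      then obtain j where "g j y \<noteq> 0" by blast
      then have "{k. g k y \<noteq> 0} \<subseteq> {j}" using disj by blast
      then show ?thesis by (rule finite_subset) simp
    qed simp
    have "finite (\<Union>y\<in>{x. a x \<noteq> 0}. {k. g k y \<noteq> 0})" using a one by blast
    then obtain N where N: "\<And>k. k \<in> (\<Union>y\<in>{x. a x \<noteq> 0}. {k. g k y \<noteq> 0}) \<Longrightarrow> k < N"
      by (metis finite_nat_set_iff_bounded)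
    have "\<mu> (g k) = 0" if "k \<ge> N" for k
      unfolding rep[OF g] using N[of k] that by (intro sum.neutral) fastforce
    then show ?thesis by blast
  qed
  define s where "s N = (\<lambda>y. \<Sum>k<N. c k * g k y)" for N
  have s: "s N \<in> topspace (Cp X)" for N
    unfolding s_def using g by (intro Cp_linear_combination) auto
  have partial: "\<exists>N. (\<Sum>k. c k * \<mu> (g k)) = \<mu> (s N)" and sm: "summable (\<lambda>k. c k * \<mu> (g k))"
    if \<mu>: "\<mu> \<in> dual fscale (Cp X)" for \<mu>
  proof -
    obtain N where N: "\<forall>k\<ge>N. \<mu> (g k) = 0" using ev[OF \<mu>] by blast
    then show "summable (\<lambda>k. c k * \<mu> (g k))" by (intro summable_finite[of "{..<N}"]) auto
    have "(\<Sum>k. c k * \<mu> (g k)) = (\<Sum>k<N. c k * \<mu> (g k))" using N by (intro suminf_finite) auto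
    also have "\<dots> = \<mu> (s N)"
      unfolding s_def using g by (intro dual_linear_combination[OF \<mu>, symmetric]) auto
    finally show "\<exists>N. (\<Sum>k. c k * \<mu> (g k)) = \<mu> (s N)" by blast
  qed
  show "(\<lambda>\<mu>. if \<mu> \<in> dual fscale (Cp X) then \<Sum>k. c k * \<mu> (g k) else 0)
           \<in> dual fscale (strong_topology fscale (Cp X))"
  proof (rule strong_dual_functional[where B = "range s"])
    show "range s \<subseteq> topspace (Cp X)" using s by blast
    fix y
    show "bdd_above ((\<lambda>f. norm (f y)) ` range s)"
    proof (cases "\<exists>j. g j y \<noteq> 0")
      case True
      then obtain j where j: "g j y \<noteq> 0" by blast
      have "s N y = (\<Sum>k<N. if k = j then c j * g j y else 0)" for N
        unfolding s_def using disj[of _ j y] j by (intro sum.cong) auto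
      then have "norm (s N y) \<le> norm (c j * g j y)" for N by (simp add: sum.delta)
      then show ?thesis by (intro bdd_aboveI[of _ "norm (c j * g j y)"]) auto
    next
      case False
      then show ?thesis by (intro bdd_aboveI[of _ 0]) (auto simp: s_def)
    qed
  next
    fix \<mu> :: "('a \<Rightarrow> 'k) \<Rightarrow> 'k" assume "\<mu> \<in> dual fscale (Cp X)"
    then show "\<exists>f\<in>range s. norm (\<Sum>k. c k * \<mu> (g k)) \<le> norm (\<mu> f)"
      using partial by (metis order_refl rangeI)
  next
    fix \<mu> \<psi> :: "('a \<Rightarrow> 'k) \<Rightarrow> 'k" assume "\<mu> \<in> dual fscale (Cp X)" "\<psi> \<in> dual fscale (Cp X)"
    then show "(\<Sum>k. c k * (\<mu> + \<psi>) (g k)) = (\<Sum>k. c k * \<mu> (g k)) + (\<Sum>k. c k * \<psi> (g k))"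
      by (simp add: distrib_left suminf_add[OF sm sm])
  next
    fix d :: 'k and \<mu> :: "('a \<Rightarrow> 'k) \<Rightarrow> 'k" assume "\<mu> \<in> dual fscale (Cp X)"
    then show "(\<Sum>k. c k * fscale d \<mu> (g k)) = d * (\<Sum>k. c k * \<mu> (g k))"
      by (simp add: fscale_def suminf_mult[OF sm, symmetric] algebra_simps)
  qed
qed

section \<open>Weakly summable sequences in the strong dual\<close>

text \<open>
  The gliding hump: were the joint support infinite, coefficients \<open>c k\<close> could be chosen such that the functional
  of the previous lemma is unbounded along the sequence, whereas weak summability makes its values tend to 0.
\<close>

lemma weakly_summable_Cp_finite_support:
  fixes \<mu> :: "nat \<Rightarrow> ('a \<Rightarrow> 'k::real_normed_field) \<Rightarrow> 'k"
  assumes X: "Tychonoff_space X" and p: "1 \<le> p"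
    and ws: "weakly_summable p fscale (strong_topology fscale (Cp X)) \<mu>"
  obtains S a where "finite S" "S \<subseteq> topspace X"
    "\<And>n f. f \<in> topspace (Cp X) \<Longrightarrow> \<mu> n f = (\<Sum>x\<in>S. a n x * f x)"
proof -
  have D: "\<mu> n \<in> dual fscale (Cp X)" for n using ws by (auto simp: weakly_summable_def)
  have "\<forall>n. \<exists>a. finite {x. a x \<noteq> 0} \<and> {x. a x \<noteq> 0} \<subseteq> topspace X
    \<and> (\<forall>f\<in>topspace (Cp X). \<mu> n f = (\<Sum>x | a x \<noteq> 0. a x * f x))"
    using dual_Cp_finite_support[OF X D] by blast
  from choice[OF this] obtain a where all: "\<forall>n. finite {x. a n x \<noteq> 0} \<and> {x. a n x \<noteq> 0} \<subseteq> topspace X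
    \<and> (\<forall>f\<in>topspace (Cp X). \<mu> n f = (\<Sum>x | a n x \<noteq> 0. a n x * f x))"
    by (elim exE)
  have a: "finite {x. a n x \<noteq> 0}" "{x. a n x \<noteq> 0} \<subseteq> topspace X" for n
    using spec[OF all, of n] by simp_all
  have rep: "\<mu> n f = (\<Sum>x | a n x \<noteq> 0. a n x * f x)" if "f \<in> topspace (Cp X)" for n f
    using spec[OF all, of n] that by (elim conjE bspec)
  define S where "S = (\<Union>n. {x. a n x \<noteq> 0})"
  have "finite S"
  proof (rule ccontr)
    assume "infinite S"
    moreover have "S \<subseteq> topspace X" using a(2) by (auto simp: S_def)
    ultimately obtain U :: "nat \<Rightarrow> 'a set" and x where U: "\<And>k. openin X (U k)" "\<And>k. x k \<in> S \<inter> U k"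
        "\<And>j k. j \<noteq> k \<Longrightarrow> U j \<inter> U k = {}"
      by (rule Tychonoff_disjoint_opens[OF X]) (rule that; assumption)
    have "\<exists>g. g \<in> topspace (Cp X) \<and> (\<forall>y. y \<notin> U k \<longrightarrow> g y = 0) \<and> (\<exists>n. \<mu> n g \<noteq> 0)" for k
    proof -
      (* Vanishing on the rest of the support of mu n, the bump g picks out the coefficient at x k. *)
      obtain n where n: "a n (x k) \<noteq> 0" using U(2)[of k] by (auto simp: S_def)
      obtain g :: "'a \<Rightarrow> 'k" where g: "g \<in> topspace (Cp X)" "g (x k) = 1"
          and zero: "\<And>y. y \<notin> U k \<or> y \<in> {y. a n y \<noteq> 0} - {x k} \<Longrightarrow> g y = 0"
        using Cp_bump[OF X a(1) U(1), of "x k" k n, where ?'k = 'k] U(2)[of k] by blast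
      have "\<mu> n g = (\<Sum>y | a n y \<noteq> 0. if y = x k then a n (x k) else 0)"
        unfolding rep[OF g(1)] using g(2) zero by (intro sum.cong) auto
      then have "\<mu> n g = a n (x k)" using a(1) n by simp
      then show ?thesis using g(1) zero n by metis
    qed
    then have "\<forall>k. \<exists>g. g \<in> topspace (Cp X) \<and> (\<forall>y. y \<notin> U k \<longrightarrow> g y = 0) \<and> (\<exists>n. \<mu> n g \<noteq> 0)"
      by blast
    from choice[OF this] obtain g where g: "\<And>k. g k \<in> topspace (Cp X)" "\<And>k y. y \<notin> U k \<Longrightarrow> g k y = 0"
        "\<And>k. \<exists>n. \<mu> n (g k) \<noteq> 0"
      by blast
    have disj: "g j y = 0 \<or> g k y = 0" if "j \<noteq> k" for j k y using U(3)[OF that] g(2) by blast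
    have "\<exists>c. \<forall>M. \<exists>n. real M \<le> norm (\<Sum>k. c k * \<mu> n (g k))"
      by (rule row_finite_matrix_unbounded)
        (rule disjoint_series_functional(1)[OF X g(1) disj D] g(3); assumption)+
    then obtain c where c: "\<And>M. \<exists>n. real M \<le> norm (\<Sum>k. c k * \<mu> n (g k))"
      by blast
    have "(\<lambda>\<nu>. if \<nu> \<in> dual fscale (Cp X) then \<Sum>k. c k * \<nu> (g k) else 0)
        \<in> dual fscale (strong_topology fscale (Cp X))"
      by (rule disjoint_series_functional(2)[OF X]) (rule g(1) disj; assumption?)+
    from weakly_summableD[OF ws this] have "(\<lambda>n. \<Sum>k. c k * \<mu> n (g k)) \<longlonglongrightarrow> 0" using in_lp_tendsto_zero[OF p] D by simp
    then have "Bseq (\<lambda>n. \<Sum>k. c k * \<mu> n (g k))" by (rule convergent_imp_Bseq[OF convergentI])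
    then obtain K where "\<And>n. norm (\<Sum>k. c k * \<mu> n (g k)) \<le> K" by (auto simp: Bseq_def)
    then show False using c reals_Archimedean2[of K] by (meson not_le order_trans)
  qed
  moreover have "S \<subseteq> topspace X" using a by (auto simp: S_def)
  moreover have "\<mu> n f = (\<Sum>x\<in>S. a n x * f x)" if "f \<in> topspace (Cp X)" for n f
    unfolding rep[OF that] using \<open>finite S\<close> by (intro sum.mono_neutral_left) (auto simp: S_def)
  ultimately show ?thesis using that by blast
qed

text \<open>
  On the unit ball a functional is bounded by the sum of the moduli of its coefficients. With a joint finite
  support this is a sum of finitely many sequences in \<open>\<ell>\<^sub>p\<close>. Without it the conclusion could fail: in an
  infinite-dimensional space weak 1-summability does not entail absolute summability.
\<close>

lemma unit_ball_Cp_Vstar: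
  assumes X: "Tychonoff_space X" and pq: "1 \<le> p" "p \<le> q"
  shows "Vstar_set p q fscale (Cp X) {f :: 'a \<Rightarrow> 'k::real_normed_field. f \<in> topspace (Cp X) \<and> (\<forall>x. norm (f x) \<le> 1)}"
    (is "Vstar_set _ _ _ _ ?A")
  unfolding Vstar_set_def
proof (intro conjI allI impI)
  have z: "0 \<in> ?A" using zero_in_Cp by simp
  then show "?A \<noteq> {}" by blast
  show "?A \<subseteq> topspace (Cp X)" by blast
  fix \<mu> :: "nat \<Rightarrow> ('a \<Rightarrow> 'k) \<Rightarrow> 'k"
  assume ws: "weakly_summable p fscale (strong_topology fscale (Cp X)) \<mu>"
  obtain S a where S: "finite S" "S \<subseteq> topspace X"
    and rep: "\<And>n f. f \<in> topspace (Cp X) \<Longrightarrow> \<mu> n f = (\<Sum>x\<in>S. a n x * f x)"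
    using weakly_summable_Cp_finite_support[OF X pq(1) ws] by metis
  have coeff: "in_lp q (\<lambda>n. a n x)" if x: "x \<in> S" for x
  proof -
    obtain g :: "'a \<Rightarrow> 'k" where g: "g \<in> topspace (Cp X)" "g x = 1"
        "\<And>y. y \<in> S - {x} \<Longrightarrow> g y = 0"
      using Cp_bump[OF X S(1) openin_topspace, of x, where ?'k = 'k] x S(2) by blast
    have "\<mu> n g = (\<Sum>y\<in>S. if y = x then a n x else 0)" for n
      unfolding rep[OF g(1)] using g S(2) by (intro sum.cong) auto
    then have "\<mu> n g = a n x" for n using S(1) x by simp
    then show ?thesis
      using in_lp_mono[OF pq weakly_summable_Cp_evaluation[OF ws g(1)]] by simp
  qed
  have bound: "norm (\<mu> n f) \<le> (\<Sum>x\<in>S. norm (a n x))" if "f \<in> ?A" for n f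
  proof -
    have "\<mu> n f = (\<Sum>x\<in>S. a n x * f x)" using that rep by blast
    also have "norm \<dots> \<le> (\<Sum>x\<in>S. norm (a n x))"
      using that by (intro sum_norm_le) (auto simp: norm_mult mult_left_le)
    finally show ?thesis .
  qed
  then have bdd: "bdd_above ((\<lambda>f. norm (\<mu> n f)) ` ?A)" for n by (intro bdd_aboveI2) blast
  have "in_lp q (\<lambda>n. SUP f\<in>?A. norm (\<mu> n f))"
  proof (rule in_lp_dominated_by_sum[OF _ S(1) coeff])
    show "1 \<le> q" using pq by simp
    fix n
    have "(SUP f\<in>?A. norm (\<mu> n f)) \<le> (\<Sum>x\<in>S. norm (a n x))"
      using z bound by (intro cSUP_least) blast+
    moreover have "0 \<le> (SUP f\<in>?A. norm (\<mu> n f))"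
      by (rule cSUP_upper2[OF bdd z]) simp
    ultimately show "norm (SUP f\<in>?A. norm (\<mu> n f)) \<le> (\<Sum>x\<in>S. norm (a n x))" by simp
  qed
  then show "sup_in_lp q \<mu> ?A" using bdd by (simp add: sup_in_lp_def)
qed

section \<open>Discreteness\<close>

text \<open>
  If the unit ball is relatively compact, its closure in \<open>C\<^sub>p(X)\<close> is closed among all functions; but bump functions
  approximate the indicator of a point on any finite set, so that indicator is continuous.
\<close>

lemma property_Vstar_imp_discrete:
  assumes X: "Tychonoff_space X" and pq: "1 \<le> p" "p \<le> q"
    and V: "property_Vstar p q fscale (Cp X :: ('a \<Rightarrow> 'k::real_normed_field) topology)"
  shows "X = discrete_topology (topspace X)"
proof -
  let ?A = "{f :: 'a \<Rightarrow> 'k. f \<in> topspace (Cp X) \<and> (\<forall>x. norm (f x) \<le> 1)}"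
  let ?P = "product_topology (\<lambda>_ :: 'a. euclidean :: 'k topology) UNIV"
  let ?K = "Cp X closure_of ?A"
  have "compactin (Cp X) ?K"
    using V unit_ball_Cp_Vstar[OF X pq, where ?'k = 'k]
    by (simp add: property_Vstar_def relatively_weakly_compact_def weak_topology_Cp)
  then have "compactin ?P ?K" and sub: "?K \<subseteq> topspace (Cp X)"
    by (auto simp: Cp_def compactin_subtopology closure_of_subset_topspace)
  then have closed: "closedin ?P ?K"
    by (intro compactin_imp_closedin) (auto simp: Hausdorff_space_product_topology)
  have "openin X {x}" if x: "x \<in> topspace X" for x
  proof -
    define \<delta> :: "'a \<Rightarrow> 'k" where "\<delta> = (\<lambda>y. if y = x then 1 else 0)"
    have "\<delta> \<in> ?P closure_of ?A"
      unfolding in_closure_of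
    proof (intro conjI allI impI; (elim conjE)?)
      fix T assume T: "\<delta> \<in> T" "openin ?P T"
      from T(2,1) obtain W where W: "finite {i. W i \<noteq> UNIV}" "\<delta> \<in> Pi UNIV W" "Pi UNIV W \<subseteq> T"
        by (rule openin_pointwise_box) (rule that; assumption)
      obtain g :: "'a \<Rightarrow> 'k" where g: "g \<in> topspace (Cp X)" "g x = 1"
          "\<And>y. y \<in> {i. W i \<noteq> UNIV} - {x} \<Longrightarrow> g y = 0" "\<And>y. norm (g y) \<le> 1"
        using Cp_bump[OF X W(1) openin_topspace x, where ?'k = 'k] by blast
      have "g i = \<delta> i" if "W i \<noteq> UNIV" for i
        using g that by (auto simp: \<delta>_def)
      then have "g i \<in> W i" for i using W(2) by (metis PiE UNIV_I)
      then show "\<exists>g. g \<in> ?A \<and> g \<in> T" using W(3) g by blast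
    qed simp
    moreover have "?A \<subseteq> ?K" by (rule closure_of_subset) blast
    ultimately have "\<delta> \<in> ?K" using closure_of_minimal[OF _ closed] by blast
    then have "continuous_map X euclidean \<delta>" using sub by (auto simp: topspace_Cp)
    then have "openin X {y \<in> topspace X. \<delta> y \<in> - {0}}"
      by (rule openin_continuous_map_preimage) (simp add: open_Compl)
    moreover have "{y \<in> topspace X. \<delta> y \<in> - {0}} = {x}" using x by (auto simp: \<delta>_def)
    ultimately show ?thesis by simp
  qed
  then show ?thesis by (metis discrete_topology_unique)
qed

lemma property_EVstar_imp_Vstar: "property_EVstar p q s E \<Longrightarrow> property_Vstar p q s E"
  unfolding property_EVstar_def property_Vstar_def Vstar_set_def EVstar_set_def by blast

text \<open>
  The test sequence is the evaluation at \<open>x\<close> followed by zeros; the conclusion is already contained in the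
  finiteness of the suprema.
\<close>

lemma EVstar_set_Cp_pointwise_bounded:
  fixes A :: "('a \<Rightarrow> 'k::real_normed_field) set"
  assumes p: "1 \<le> p" and A: "EVstar_set p q fscale (Cp X) A"
  shows "bdd_above ((\<lambda>f. norm (f x)) ` A)"
proof -
  define \<mu> :: "nat \<Rightarrow> ('a \<Rightarrow> 'k) \<Rightarrow> 'k" where "\<mu> n = (if n = 0 then evaluation X x else 0)" for n
  have D: "\<mu> n \<in> dual fscale (Cp X)" for n by (auto simp: \<mu>_def evaluation_in_dual dual_zero)
  define U where "U = {f \<in> topspace (Cp X). f x \<in> ball (0 :: 'k) 1}"
  have "openin (Cp X) U"
    unfolding U_def by (rule openin_continuous_map_preimage[OF continuous_map_Cp_coordinate]) simp
  then have "zero_nbhd (Cp X) U"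
    using zero_in_Cp[of X] unfolding zero_nbhd_def by (intro conjI exI[of _ U]) (auto simp: U_def)
  moreover have "range \<mu> \<subseteq> polar fscale (Cp X) U"
    by (auto simp: polar_def U_def \<mu>_def evaluation_in_dual dual_zero) (auto simp: evaluation_def)
  ultimately have "equicontinuous fscale (Cp X) (range \<mu>)" by (auto simp: equicontinuous_def)
  moreover have "weakly_summable p fscale (strong_topology fscale (Cp X)) \<mu>"
    unfolding weakly_summable_def
  proof (intro conjI ballI)
    fix \<Phi> :: "(('a \<Rightarrow> 'k) \<Rightarrow> 'k) \<Rightarrow> 'k" assume "\<Phi> \<in> dual fscale (strong_topology fscale (Cp X))"
    then have "\<Phi> (fscale 0 0) = 0 * \<Phi> 0" using dual_zero by (fastforce simp: dual_def)
    then have "\<Phi> 0 = 0" by (simp add: fscale_def zero_fun_def)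
    then have "\<Phi> (\<mu> n) = 0" if "n \<notin> {0}" for n using that by (simp add: \<mu>_def)
    then show "in_lp p (\<lambda>n. \<Phi> (\<mu> n))"
      unfolding in_lp_def
      by (auto intro!: tendsto_eventually eventually_sequentiallyI[of 1]) (rule summable_finite[of "{0}"]; simp)
  qed (use D in auto)
  ultimately have "bdd_above ((\<lambda>f. norm (\<mu> 0 f)) ` A)" "A \<subseteq> topspace (Cp X)"
    using A by (auto simp: EVstar_set_def sup_in_lp_def)
  moreover have "(\<lambda>f. norm (\<mu> 0 f)) ` A = (\<lambda>f. norm (f x)) ` A"
    using \<open>A \<subseteq> topspace (Cp X)\<close> by (intro image_cong) (auto simp: \<mu>_def evaluation_def)
  ultimately show ?thesis by simp
qed

text \<open>
  By Tychonoff's theorem a product of closed balls is compact, and it consists of continuous functions when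
  \<open>X\<close> is discrete. The factor \<open>{0}\<close> outside \<open>topspace X\<close> matches the extension of functions by 0.
\<close>

lemma discrete_imp_property_EVstar:
  assumes X: "X = discrete_topology (topspace X)" and p: "1 \<le> p"
  shows "property_EVstar p q fscale (Cp X :: ('a \<Rightarrow> 'k::{real_normed_field,heine_borel}) topology)"
  unfolding property_EVstar_def relatively_weakly_compact_def weak_topology_Cp
proof (intro allI impI)
  fix A :: "('a \<Rightarrow> 'k) set" assume A: "EVstar_set p q fscale (Cp X) A"
  let ?P = "product_topology (\<lambda>_ :: 'a. euclidean :: 'k topology) UNIV"
  obtain M where M: "\<And>x f. f \<in> A \<Longrightarrow> norm (f x) \<le> M x"
    using EVstar_set_Cp_pointwise_bounded[OF p A] unfolding bdd_above_def by (metis imageI)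
  define C where "C = (\<Pi>\<^sub>E x\<in>UNIV. if x \<in> topspace X then cball (0::'k) (M x) else {0})"
  have "continuous_map X euclidean f" for f :: "'a \<Rightarrow> 'k"
    using continuous_map_from_discrete_topology[of "topspace X" euclidean f] X by simp
  then have sub: "C \<subseteq> topspace (Cp X)" by (auto simp: C_def topspace_Cp PiE_def Pi_def)
  have compact: "compactin ?P C" unfolding C_def by (subst compactin_PiE) auto
  then have "closedin ?P C"
    by (intro compactin_imp_closedin) (auto simp: Hausdorff_space_product_topology)
  then have "closedin (Cp X) C"
    using sub unfolding topspace_Cp by (simp add: Cp_def closedin_subset_topspace)
  moreover have "A \<subseteq> C"
  proof
    fix f assume f: "f \<in> A"
    then have "f x = 0" if "x \<notin> topspace X" for x
      using A that by (auto simp: EVstar_set_def topspace_Cp)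
    then show "f \<in> C" using M[OF f] by (simp add: C_def PiE_iff)
  qed
  ultimately have "Cp X closure_of A \<subseteq> C" by (intro closure_of_minimal)
  moreover have "compactin (Cp X) C"
    using compact sub unfolding Cp_def by (simp add: compactin_subtopology)
  ultimately show "compactin (Cp X) (Cp X closure_of A)"
    using closed_compactin closedin_closure_of by metis
qed

theorem corollary11p11:
  fixes X :: "'a topology" and p q :: ereal
  assumes "1 \<le> p" and "p \<le> q" and "Tychonoff_space X"
  shows
    "((property_EVstar p q fscale (Cp X :: ('a \<Rightarrow> real) topology)
         \<longleftrightarrow> property_Vstar p q fscale (Cp X :: ('a \<Rightarrow> real) topology))
      \<and> (property_Vstar p q fscale (Cp X :: ('a \<Rightarrow> real) topology)
         \<longleftrightarrow> X = discrete_topology (topspace X)))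
    \<and> ((property_EVstar p q fscale (Cp X :: ('a \<Rightarrow> complex) topology)
         \<longleftrightarrow> property_Vstar p q fscale (Cp X :: ('a \<Rightarrow> complex) topology))
      \<and> (property_Vstar p q fscale (Cp X :: ('a \<Rightarrow> complex) topology)
         \<longleftrightarrow> X = discrete_topology (topspace X)))"
proof (intro conjI iffI)
qed (use assms property_EVstar_imp_Vstar property_Vstar_imp_discrete discrete_imp_property_EVstar in blast)+

end
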